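(* For every prime number $p$ and all integers $0\le k\le m$, $$s_p(\Delta_{(k+1)}^{m+1})\le s_p(\Delta_{(k)}^{m})\le s_p(\Delta_{(k)}^{m+1})\le s_p(\Delta_{(k)}^{m})+1.$$
   Context: $\Delta^m$ is the $m$-simplex on the vertex set $[m+1]=\{1,\dots,m+1\}$ and $\Delta^m_{(k)}$ is its $k$-skeleton (all subsets of $[m+1]$ with at most $k+1$ elements). $K(\mathbb{F}_p^r)$ is the simplicial complex whose vertices are the $1$-dimensional subspaces (lines) of $\mathbb{F}_p^r$ and whose simplices are the sets of lines $\{l_1,\dots,l_t\}$ spanning a $t$-dimensional subspace. A simplicial map is nondegenerate if it is injective on the vertex set of each simplex. For a simplicial complex $\mathcal{K}$ with $N$ vertices, the mod $p$ Buchstaber invariant is $s_p(\mathcal{K})=N-r$, where $r$ is the least integer such that there is a nondegenerate simplicial map $\mathcal{K}\to K(\mathbb{F}_p^r)$. *)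

theory Defs
  imports
    "HOL-Number_Theory.Residues"
    "Jordan_Normal_Form.Missing_VectorSpace"
begin

section \<open>Simplicial complexes\<close>

text \<open>A simplicial complex is represented by its set of simplices, the empty simplex included.\<close>

definition simplicial_complex :: "'a set set \<Rightarrow> bool" where
  "simplicial_complex \<K> \<longleftrightarrow>
     {} \<in> \<K> \<and> (\<forall>\<sigma>\<in>\<K>. finite \<sigma> \<and> (\<forall>\<tau>. \<tau> \<subseteq> \<sigma> \<longrightarrow> \<tau> \<in> \<K>))"

definition vertices :: "'a set set \<Rightarrow> 'a set" where
  "vertices \<K> = \<Union>\<K>"

definition skeleton :: "nat \<Rightarrow> 'a set set \<Rightarrow> 'a set set" where
  "skeleton k \<K> = {\<sigma> \<in> \<K>. card \<sigma> \<le> k + 1}"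

definition std_simplex :: "nat \<Rightarrow> nat set set" where
  "std_simplex m = Pow {1..m + 1}"

definition simplicial_map :: "'a set set \<Rightarrow> 'b set set \<Rightarrow> ('a \<Rightarrow> 'b) \<Rightarrow> bool" where
  "simplicial_map \<K> \<L> f \<longleftrightarrow>
     f ` vertices \<K> \<subseteq> vertices \<L> \<and> (\<forall>\<sigma>\<in>\<K>. f ` \<sigma> \<in> \<L>)"

definition nondegenerate :: "'a set set \<Rightarrow> ('a \<Rightarrow> 'b) \<Rightarrow> bool" where
  "nondegenerate \<K> f \<longleftrightarrow> (\<forall>\<sigma>\<in>\<K>. inj_on f \<sigma>)"

lemma simplicial_complex_skeleton_std_simplex:
  "simplicial_complex (skeleton k (std_simplex m))"
  unfolding simplicial_complex_def
proof (intro conjI ballI allI impI)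
  show "{} \<in> skeleton k (std_simplex m)"
    by (simp add: skeleton_def std_simplex_def)
next
  fix \<sigma> assume \<sigma>: "\<sigma> \<in> skeleton k (std_simplex m)"
  then show fin: "finite \<sigma>"
    by (auto simp: skeleton_def std_simplex_def dest: finite_subset)
  fix \<tau> assume "\<tau> \<subseteq> \<sigma>"
  with \<sigma> card_mono[OF fin this] show "\<tau> \<in> skeleton k (std_simplex m)"
    by (auto simp: skeleton_def std_simplex_def)
qed

section \<open>The complex of lines of a coordinate space over a prime field\<close>

text \<open>
  The space of functions from the index set \<open>{..<r}\<close> to the field of integers modulo \<open>p\<close>.
\<close>

definition prime_field_space :: "nat \<Rightarrow> nat \<Rightarrow> (int, nat \<Rightarrow> int) module" where
  "prime_field_space p r = LinearCombinations.ring.func_space (residue_ring (int p)) {..<r}"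

definition subspace_dim :: "nat \<Rightarrow> nat \<Rightarrow> (nat \<Rightarrow> int) set \<Rightarrow> nat" where
  "subspace_dim p r W =
     vectorspace.dim (residue_ring (int p)) (prime_field_space p r\<lparr>carrier := W\<rparr>)"

definition lines :: "nat \<Rightarrow> nat \<Rightarrow> (nat \<Rightarrow> int) set set" where
  "lines p r = {l. VectorSpace.subspace (residue_ring (int p)) l (prime_field_space p r) \<and>
                   subspace_dim p r l = 1}"

definition universal_complex :: "nat \<Rightarrow> nat \<Rightarrow> (nat \<Rightarrow> int) set set set" where
  "universal_complex p r =
     {L. finite L \<and> L \<subseteq> lines p r \<and>
         subspace_dim p r
           (LinearCombinations.module.span (residue_ring (int p)) (prime_field_space p r) (\<Union>L))
         = card L}"

section \<open>The mod p Buchstaber invariant\<close>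

text \<open>
  Meant for a finite simplicial complex and a prime \<open>p\<close>; the least dimension then exists, since
  the vertices can be sent to the coordinate axes. The value is an integer, so that the
  subtraction is not truncated.
\<close>

definition buchstaber :: "nat \<Rightarrow> 'a set set \<Rightarrow> int" where
  "buchstaber p \<K> =
     int (card (vertices \<K>)) -
     int (LEAST r. \<exists>f. simplicial_map \<K> (universal_complex p r) f \<and> nondegenerate \<K> f)"

end

theory Submission
  imports Defs
begin

text \<open>
  A nondegenerate map into the complex of lines amounts to a choice of a vector over the prime field
  for each vertex such that the vectors of every simplex are independent. Let \<open>R k m\<close> be the least
  dimension in which \<open>m + 1\<close> vectors exist any \<open>k + 1\<close> of which are independent. Forgetting a vector
  gives \<open>R k m \<le> R k (m + 1)\<close>, a new vector along a new coordinate axis gives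
  \<open>R k (m + 1) \<le> R k m + 1\<close>, and dividing out the line of the last vector gives
  \<open>R k m + 1 \<le> R (k + 1) (m + 1)\<close>.
\<close>

section \<open>Independence in terms of lines\<close>

lemma (in vectorspace) dim_span_lin_indpt:
  assumes "finite A" "A \<subseteq> carrier V" "lin_indpt A"
  shows "vectorspace.dim K (vs (span A)) = card A"
proof -
  interpret W: vectorspace K "vs (span A)"
    using subspace_is_vs span_is_subspace assms(2) by blast
  have sub: "A \<subseteq> span A" "submodule K (span A) V"
    using in_own_span span_is_submodule assms(2) by auto
  have "W.basis A"
    unfolding W.basis_def using span_li_not_depend[OF sub] sub assms(3) by simp
  then show ?thesis
    using W.dim_basis assms(1) by simp
qed

text \<open>\<open>A\<close> generates its span, and a generating set with at most as many elements
  as the dimension is a basis.\<close>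

lemma (in vectorspace) lin_indpt_of_card_le_dim_span:
  assumes "finite A" "A \<subseteq> carrier V" "card A \<le> vectorspace.dim K (vs (span A))"
  shows "lin_indpt A"
proof -
  interpret W: vectorspace K "vs (span A)"
    using subspace_is_vs span_is_subspace assms(2) by blast
  have sub: "A \<subseteq> span A" "submodule K (span A) V"
    using in_own_span span_is_submodule assms(2) by auto
  have "W.basis A"
    by (rule W.dim_gen_is_basis) (use assms sub span_li_not_depend[OF sub] in simp_all)
  then show ?thesis
    unfolding W.basis_def using span_li_not_depend[OF sub] by simp
qed

lemma (in vectorspace) span_Union_span_singletons:
  assumes "A \<subseteq> carrier V"
  shows "span (\<Union>x\<in>A. span {x}) = span A"
proof
  have "span {x} \<subseteq> span A" if "x \<in> A" for x
    using that by (intro span_is_monotone) simp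
  then show "span (\<Union>x\<in>A. span {x}) \<subseteq> span A"
    using assms by (intro span_is_subset span_is_submodule) blast+
  have "x \<in> span {x}" if "x \<in> A" for x
    using that assms by (intro span_mem) auto
  then show "span A \<subseteq> span (\<Union>x\<in>A. span {x})"
    by (intro span_is_monotone) blast
qed

text \<open>The lines and the vectors \<open>v j\<close> span the same subspace. If the lines are
  distinct and as many as its dimension, then the vectors generate it without exceeding that
  dimension, so they are a basis. Conversely, two equal lines would put one vector of an independent
  family into the span of another.\<close>

lemma (in vectorspace) lin_indpt_iff_dim_span_lines:
  assumes "finite S" "v \<in> S \<rightarrow> carrier V"
  shows "inj_on (\<lambda>j. span {v j}) S \<and>
         vectorspace.dim K (vs (span (\<Union>j\<in>S. span {v j}))) = card ((\<lambda>j. span {v j}) ` S)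
         \<longleftrightarrow> inj_on v S \<and> lin_indpt (v ` S)" (is "inj_on ?l S \<and> ?d = _ \<longleftrightarrow> ?R")
proof
  have sub: "v ` S \<subseteq> carrier V" and fin: "finite (v ` S)"
    using assms by auto
  have span: "span (\<Union>j\<in>S. span {v j}) = span (v ` S)"
    using span_Union_span_singletons[OF sub] by simp
  {
    assume L: "inj_on ?l S \<and> ?d = card (?l ` S)"
    then have "card (v ` S) \<le> ?d"
      using assms(1) by (simp add: card_image card_image_le)
    then have "lin_indpt (v ` S)"
      using lin_indpt_of_card_le_dim_span fin sub span by simp
    moreover have "inj_on v S"
      using L by (metis (mono_tags, lifting) inj_on_def)
    ultimately show ?R by simp
  next
    assume R: ?R
    have "inj_on ?l S"
    proof (rule inj_onI, rule ccontr)
      fix i j assume ij: "i \<in> S" "j \<in> S" "span {v i} = span {v j}" "i \<noteq> j"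
      then have "v i \<in> span {v j}"
        using assms(2) span_self by auto
      moreover have "{v j} \<subseteq> v ` S - {v i}"
        using R ij by (auto dest: inj_onD)
      ultimately have "v i \<in> span (v ` S - {v i})"
        using span_is_monotone by blast
      then show False
        using R ij(1) lindep_span[OF sub fin] by blast
    qed
    then show "inj_on ?l S \<and> ?d = card (?l ` S)"
      using R dim_span_lin_indpt[OF fin sub] span by (simp add: card_image)
  }
qed

lemma (in vectorspace) subspace_dim_1_imp_span_singleton:
  assumes "subspace K W V" "finite W" "vectorspace.dim K (vs W) = 1"
  shows "\<exists>v\<in>carrier V. W = span {v}"
proof -
  interpret W: vectorspace K "vs W"
    using subspace_is_vs assms(1) .
  have sub: "submodule K W V"
    using assms(1) by simp
  \<comment> \<open>A finite subspace generates itself, so finiteness supplies the finite generating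
    set.\<close>
  have "W.fin_dim"
    unfolding W.fin_dim_def using assms(2) W.in_own_span[of W] W.span_is_subset2[of W]
    by (intro exI[of _ W]) auto
  then obtain B where B: "finite B" "W.basis B"
    using W.finite_basis_exists by blast
  then have "card B = 1"
    using W.dim_basis assms(3) by simp
  then obtain v where v: "B = {v}"
    by (rule card_1_singletonE)
  have "v \<in> W" "W.span {v} = W"
    using B(2) unfolding W.basis_def v by auto
  then show ?thesis
    using span_li_not_depend(1)[OF _ sub, of "{v}"] submodule.subset[OF sub] by auto
qed

lemma (in vectorspace) subspace_dim_span_singleton:
  assumes "v \<in> carrier V" "lin_indpt {v}"
  shows "subspace K (span {v}) V" "vectorspace.dim K (vs (span {v})) = 1"
  using span_is_subspace dim_span_lin_indpt[of "{v}"] assms by auto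

section \<open>Integer vectors independent modulo a prime\<close>

text \<open>Integer vectors and coefficients with divisibility replace residues, so no carrier
  conditions arise when vectors are modified. Independence is that of a family indexed by
  \<open>S\<close>: a repeated vector makes it dependent. Only the coordinates below
  \<open>r\<close> count.\<close>

definition indep_mod :: "nat \<Rightarrow> nat \<Rightarrow> ('a \<Rightarrow> nat \<Rightarrow> int) \<Rightarrow> 'a set \<Rightarrow> bool" where
  "indep_mod p r v S \<longleftrightarrow>
     (\<forall>c. (\<forall>i<r. int p dvd (\<Sum>j\<in>S. c j * v j i)) \<longrightarrow> (\<forall>j\<in>S. int p dvd c j))"

lemma indep_mod_cong_mod:
  assumes "\<And>j i. j \<in> S \<Longrightarrow> i < r \<Longrightarrow> [v j i = w j i] (mod int p)"
  shows "indep_mod p r v S \<longleftrightarrow> indep_mod p r w S"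
proof -
  have "int p dvd (\<Sum>j\<in>S. c j * v j i) \<longleftrightarrow> int p dvd (\<Sum>j\<in>S. c j * w j i)" if "i < r" for c i
    using assms that by (intro cong_dvd_iff cong_sum cong_mult cong_refl)
  then show ?thesis
    unfolding indep_mod_def by simp
qed

section \<open>Linear independence over the prime field expressed by divisibility\<close>

context residues_prime
begin

lemma vectorspace_prime_field_space: "vectorspace R (prime_field_space p r)"
  unfolding prime_field_space_def R_def[symmetric]
  using func_space_is_module field_axioms
  by (simp add: vectorspace_def)

lemma carrier_prime_field_space:
  "carrier (prime_field_space p r) = {..<r} \<rightarrow>\<^sub>E {0..<int p}"
  unfolding prime_field_space_def R_def[symmetric] func_space_def
  by (auto simp: res_carrier_eq PiE_def Pi_def)

lemma lincomb_prime_field_space: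
  assumes "finite A" "A \<subseteq> carrier (prime_field_space p r)" "a \<in> A \<rightarrow> carrier R"
  shows "LinearCombinations.module.lincomb (prime_field_space p r) a A =
         (\<lambda>i\<in>{..<r}. (\<Sum>x\<in>A. a x * x i) mod int p)"
proof -
  interpret V: vectorspace R "prime_field_space p r"
    by (rule vectorspace_prime_field_space)
  show ?thesis
    using assms
  proof (induction A rule: finite_induct)
    case empty
    show ?case
      unfolding V.lincomb_empty
      by (simp add: prime_field_space_def R_def[symmetric] func_space_def res_zero_eq)
  next
    case (insert x A)
    have "V.lincomb a (insert x A) =
        a x \<odot>\<^bsub>prime_field_space p r\<^esub> x \<oplus>\<^bsub>prime_field_space p r\<^esub> V.lincomb a A"
      using insert.hyps insert.prems by (intro V.lincomb_insert2) auto
    also have "\<dots> = (\<lambda>i\<in>{..<r}. (\<Sum>x\<in>insert x A. a x * x i) mod int p)"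
      using insert
      by (auto simp: prime_field_space_def R_def[symmetric] func_space_def res_add_eq res_mult_eq
          mod_simps intro!: restrict_ext)
    finally show ?case .
  qed
qed

text \<open>Relations with integer coefficients and relations with coefficients in the residue ring
  correspond by reduction modulo \<open>p\<close>. Injectivity of \<open>w\<close> appears because
  \<open>lin_dep\<close> speaks of the set of vectors and \<open>indep_mod\<close> of the
  family.\<close>

lemma indep_mod_iff_lin_indpt:
  assumes "finite S" "w \<in> S \<rightarrow> carrier (prime_field_space p r)"
  shows "indep_mod p r w S \<longleftrightarrow>
         inj_on w S \<and> \<not> LinearCombinations.module.lin_dep R (prime_field_space p r) (w ` S)"
proof -
  interpret V: vectorspace R "prime_field_space p r"
    by (rule vectorspace_prime_field_space)
  have sub: "w ` S \<subseteq> carrier (prime_field_space p r)" and fin: "finite (w ` S)"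
    using assms by auto
  have p1: "1 < int p"
    using m_gt_one .
  have zero: "\<zero>\<^bsub>prime_field_space p r\<^esub> = (\<lambda>i\<in>{..<r}. 0)"
    by (simp add: prime_field_space_def R_def[symmetric] func_space_def res_zero_eq)
  have lincomb: "V.lincomb a (w ` S) = \<zero>\<^bsub>prime_field_space p r\<^esub> \<longleftrightarrow>
      (\<forall>i<r. int p dvd (\<Sum>j\<in>S. a (w j) * w j i))"
    if "a \<in> w ` S \<rightarrow> carrier R" "inj_on w S" for a
    unfolding lincomb_prime_field_space[OF fin sub that(1)] zero
    by (auto simp: sum.reindex[OF that(2)] fun_eq_iff restrict_def dvd_eq_mod_eq_0)
  show ?thesis
  proof (intro iffI conjI)
    assume indep: "indep_mod p r w S"
    show inj: "inj_on w S"
    proof (rule inj_onI, rule ccontr)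
      fix a b assume ab: "a \<in> S" "b \<in> S" "w a = w b" "a \<noteq> b"
      \<comment> \<open>If \<open>w a = w b\<close>, then \<open>w a - w b\<close> is a vanishing
        combination whose coefficient at \<open>a\<close> is 1.\<close>
      define c :: "'a \<Rightarrow> int" where "c j = of_bool (j = a) - of_bool (j = b)" for j
      have "(\<Sum>j\<in>S. c j * w j i) = 0" for i
        using ab assms(1)
        by (simp add: c_def left_diff_distrib sum_subtractf of_bool_def
            if_distrib[of "\<lambda>x. x * _"] cong: if_cong)
      then have "int p dvd c a"
        using indep ab(1) unfolding indep_mod_def by simp
      then show False
        using ab(4) p1 by (simp add: c_def)
    qed
    show "V.lin_indpt (w ` S)"
    proof (rule V.finite_lin_indpt2[OF fin sub], intro ballI)
      fix a x assume a: "a \<in> w ` S \<rightarrow> carrier R" "V.lincomb a (w ` S) = \<zero>\<^bsub>prime_field_space p r\<^esub>"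
        and x: "x \<in> w ` S"
      then have "int p dvd a x"
        using indep[unfolded indep_mod_def, rule_format, of "\<lambda>j. a (w j)"] lincomb[OF a(1) inj] by auto
      moreover have "0 \<le> a x" "a x < int p"
        using a(1) x by (auto simp: res_carrier_eq)
      \<comment> \<open>The only multiple of \<open>p\<close> among the representatives from 0 to
        \<open>p - 1\<close> is 0.\<close>
      ultimately show "a x = \<zero>"
        by (auto simp: res_zero_eq order_le_less zdvd_not_zless)
    qed
  next
    assume R: "inj_on w S \<and> V.lin_indpt (w ` S)"
    show "indep_mod p r w S"
      unfolding indep_mod_def
    proof (intro allI impI ballI)
      fix c j assume c: "\<forall>i<r. int p dvd (\<Sum>j\<in>S. c j * w j i)" and j: "j \<in> S"
      \<comment> \<open>The coefficients are carried from indices to vectors, which needs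
        \<open>w\<close> injective, and reduced into the carrier of the field.\<close>
      define a where "a x = c (inv_into S w x) mod int p" for x
      have a: "a \<in> w ` S \<rightarrow> carrier R"
        using p1 by (auto simp: a_def res_carrier_eq)
      have aw: "a (w j) = c j mod int p" if "j \<in> S" for j
        using that R by (simp add: a_def)
      have "int p dvd (\<Sum>j\<in>S. a (w j) * w j i) \<longleftrightarrow> int p dvd (\<Sum>j\<in>S. c j * w j i)" for i
        by (intro cong_dvd_iff cong_sum cong_mult) (auto simp: aw)
      then have "V.lincomb a (w ` S) = \<zero>\<^bsub>prime_field_space p r\<^esub>"
        using c R by (simp add: lincomb[OF a])
      then have "a \<in> w ` S \<rightarrow> {\<zero>}"
        using V.not_lindepD R fin a by blast
      then have "a (w j) = \<zero>"
        using j by blast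
      then show "int p dvd c j"
        using aw[OF j] by (auto simp: res_zero_eq)
    qed
  qed
qed

end

text \<open>From a map to vectors: each vertex is a simplex by itself, so its image is a line, and a
  generator of it is chosen. From vectors to a map: the vectors are reduced modulo \<open>p\<close>
  and each vertex goes to the line spanned by its vector. On every simplex,
  \<open>lin_indpt_iff_dim_span_lines\<close> matches the two conditions.\<close>

lemma nondegenerate_map_iff_indep_mod:
  fixes \<K> :: "'a set set"
  assumes "prime p" "simplicial_complex \<K>"
  shows "(\<exists>f. simplicial_map \<K> (universal_complex p r) f \<and> nondegenerate \<K> f) \<longleftrightarrow>
         (\<exists>v. \<forall>\<sigma>\<in>\<K>. indep_mod p r v \<sigma>)"
proof -
  interpret residues_prime p "residue_ring (int p)"
    by (rule residues_prime.intro) (use assms in simp_all)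
  interpret V: vectorspace "residue_ring (int p)" "prime_field_space p r"
    by (rule vectorspace_prime_field_space)
  have fin: "finite \<sigma>" if "\<sigma> \<in> \<K>" for \<sigma>
    using assms(2) that by (auto simp: simplicial_complex_def)
  have single: "{x} \<in> \<K>" if "x \<in> vertices \<K>" for x
    using assms(2) that by (auto simp: simplicial_complex_def vertices_def)
  have vert: "\<sigma> \<subseteq> vertices \<K>" if "\<sigma> \<in> \<K>" for \<sigma>
    using that by (auto simp: vertices_def)
  have finV: "finite (carrier (prime_field_space p r))"
    by (simp add: carrier_prime_field_space finite_PiE)
  let ?K = "residue_ring (int p)" and ?V = "prime_field_space p r"
  show ?thesis
  proof
    assume "\<exists>f. simplicial_map \<K> (universal_complex p r) f \<and> nondegenerate \<K> f"
    then obtain f where f: "simplicial_map \<K> (universal_complex p r) f" "nondegenerate \<K> f"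
      by blast
    have "\<exists>v\<in>carrier ?V. f x = V.span {v}" if "x \<in> vertices \<K>" for x
    proof -
      have "f x \<in> lines p r"
        using f(1) single[OF that] by (force simp: simplicial_map_def universal_complex_def)
      then have "subspace ?K (f x) ?V" "vectorspace.dim ?K (V.vs (f x)) = 1"
        by (auto simp: lines_def subspace_dim_def)
      moreover have "finite (f x)"
        using submodule.subset[OF V.is_module[OF calculation(1)]] finV by (rule finite_subset)
      ultimately show ?thesis
        using V.subspace_dim_1_imp_span_singleton by blast
    qed
    then obtain v where v: "\<And>x. x \<in> vertices \<K> \<Longrightarrow> v x \<in> carrier ?V \<and> f x = V.span {v x}"
      by metis
    have "indep_mod p r v \<sigma>" if \<sigma>: "\<sigma> \<in> \<K>" for \<sigma>
    proof -
      have v\<sigma>: "v \<in> \<sigma> \<rightarrow> carrier ?V" and f\<sigma>: "\<And>x. x \<in> \<sigma> \<Longrightarrow> f x = V.span {v x}"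
        using v vert[OF \<sigma>] by auto
      have "inj_on f \<sigma>" "f ` \<sigma> \<in> universal_complex p r"
        using f \<sigma> by (auto simp: nondegenerate_def simplicial_map_def)
      then have "inj_on v \<sigma> \<and> V.lin_indpt (v ` \<sigma>)"
        using V.lin_indpt_iff_dim_span_lines[OF fin[OF \<sigma>] v\<sigma>] f\<sigma>
        by (simp add: universal_complex_def subspace_dim_def cong: inj_on_cong image_cong)
      then show ?thesis
        using indep_mod_iff_lin_indpt[OF fin[OF \<sigma>] v\<sigma>] by simp
    qed
    then show "\<exists>v. \<forall>\<sigma>\<in>\<K>. indep_mod p r v \<sigma>"
      by blast
  next
    assume "\<exists>v. \<forall>\<sigma>\<in>\<K>. indep_mod p r v \<sigma>"
    then obtain v :: "'a \<Rightarrow> nat \<Rightarrow> int" where v: "\<And>\<sigma>. \<sigma> \<in> \<K> \<Longrightarrow> indep_mod p r v \<sigma>"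
      by blast
    \<comment> \<open>Reduction modulo \<open>p\<close> and truncation to \<open>r\<close>
      coordinates put the vectors into the carrier without affecting independence.\<close>
    define w where "w j = (\<lambda>i\<in>{..<r}. v j i mod int p)" for j
    define f where "f j = V.span {w j}" for j
    have w: "w \<in> S \<rightarrow> carrier ?V" for S
      using m_gt_one by (auto simp: w_def carrier_prime_field_space)
    have indep: "inj_on w \<sigma> \<and> V.lin_indpt (w ` \<sigma>)" if "\<sigma> \<in> \<K>" for \<sigma>
      using v[OF that] indep_mod_iff_lin_indpt[OF fin[OF that] w]
        indep_mod_cong_mod[of \<sigma> r w v p] by (simp add: w_def)
    have lines: "f x \<in> lines p r" if "x \<in> vertices \<K>" for x
      using V.subspace_dim_span_singleton[of "w x"] w[of "{x}"] indep[OF single[OF that]]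
      by (simp add: lines_def subspace_dim_def f_def)
    have simplex: "inj_on f \<sigma> \<and> f ` \<sigma> \<in> universal_complex p r" if \<sigma>: "\<sigma> \<in> \<K>" for \<sigma>
    proof -
      have "inj_on f \<sigma> \<and> vectorspace.dim ?K (V.vs (V.span (\<Union>j\<in>\<sigma>. f j))) = card (f ` \<sigma>)"
        unfolding f_def using V.lin_indpt_iff_dim_span_lines[OF fin[OF \<sigma>] w] indep[OF \<sigma>] by simp
      then show ?thesis
        using lines vert[OF \<sigma>] fin[OF \<sigma>]
        by (auto simp: universal_complex_def subspace_dim_def)
    qed
    have "f x \<in> vertices (universal_complex p r)" if "x \<in> vertices \<K>" for x
      using simplex[OF single[OF that]] by (auto simp: vertices_def)
    then show "\<exists>f. simplicial_map \<K> (universal_complex p r) f \<and> nondegenerate \<K> f"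
      using simplex by (auto simp: simplicial_map_def nondegenerate_def)
  qed
qed


section \<open>Independence when a coordinate is added or projected away\<close>

lemma indep_mod_singletonD:
  assumes "prime p" "indep_mod p r v {x}"
  shows "\<exists>i<r. \<not> int p dvd v x i"
proof (rule ccontr)
  assume "\<not> ?thesis"
  then have "int p dvd 1"
    using assms(2)[unfolded indep_mod_def, rule_format, of "\<lambda>_. 1" x] by simp
  then show False
    using assms(1) by (simp add: not_prime_unit)
qed

text \<open>Only \<open>x\<close> has a nonzero entry in the new coordinate \<open>r\<close>, so
  that coordinate of a relation forces the coefficient of \<open>x\<close> to vanish modulo
  \<open>p\<close>. The old coordinates then give a relation among the vectors of
  \<open>S - {x}\<close>.\<close>

lemma indep_mod_add_coordinate:
  assumes "finite S" "indep_mod p r v (S - {x})"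
  shows "indep_mod p (Suc r) (\<lambda>j i. if j = x then of_bool (i = r) else of_bool (i < r) * v j i) S"
    (is "indep_mod _ _ ?w _")
  unfolding indep_mod_def
proof (intro allI impI ballI)
  fix c j assume c: "\<forall>i<Suc r. int p dvd (\<Sum>j\<in>S. c j * ?w j i)" and j: "j \<in> S"
  have split: "(\<Sum>j\<in>S. c j * ?w j i) =
      (if x \<in> S then c x * of_bool (i = r) else 0) + of_bool (i < r) * (\<Sum>j\<in>S - {x}. c j * v j i)" for i
  proof -
    have "sum g S = (if x \<in> S then g x else 0) + sum g (S - {x})" for g :: "'a \<Rightarrow> int"
      using assms(1) by (simp add: sum.remove)
    then have "(\<Sum>j\<in>S. c j * ?w j i) =
        (if x \<in> S then c x * ?w x i else 0) + (\<Sum>j\<in>S - {x}. c j * ?w j i)" .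
    also have "(\<Sum>j\<in>S - {x}. c j * ?w j i) = of_bool (i < r) * (\<Sum>j\<in>S - {x}. c j * v j i)"
      unfolding sum_distrib_left by (intro sum.cong) auto
    finally show ?thesis
      by simp
  qed
  show "int p dvd c j"
  proof (cases "j = x")
    case True
    then show ?thesis
      using c[rule_format, of r] j by (simp add: split)
  next
    case False
    have "\<forall>i<r. int p dvd (\<Sum>j\<in>S - {x}. c j * v j i)"
    proof (intro allI impI)
      fix i assume "i < r"
      then show "int p dvd (\<Sum>j\<in>S - {x}. c j * v j i)"
        using c[rule_format, of i] by (simp add: split split: if_splits)
    qed
    then show ?thesis
      using assms(2) False j unfolding indep_mod_def by blast
  qed
qed

text \<open>
  The projection along \<open>v x\<close> onto the hyperplane where coordinate \<open>k\<close> vanishes, scaled by \<open>v x k\<close> to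
  avoid inverses; that coordinate is then left out.
\<close>

lemma indep_mod_project:
  assumes "prime p" "finite S" "x \<notin> S" "indep_mod p (Suc r) v (insert x S)"
    and k: "k \<le> r" "\<not> int p dvd v x k"
  defines "skip \<equiv> \<lambda>i. if i < k then i else Suc i"
  shows "indep_mod p r (\<lambda>j i. v x k * v j (skip i) - v j k * v x (skip i)) S"
  unfolding indep_mod_def
proof (intro allI impI ballI)
  fix c j
  assume c: "\<forall>i<r. int p dvd (\<Sum>j\<in>S. c j * (v x k * v j (skip i) - v j k * v x (skip i)))"
    and j: "j \<in> S"
  \<comment> \<open>A relation \<open>c\<close> among the projected vectors lifts to a relation
    \<open>d\<close> among the original ones: collecting the multiples of \<open>v x\<close> that
    were subtracted gives its coefficient.\<close>
  define d where "d j = (if j = x then - (\<Sum>j\<in>S. c j * v j k) else v x k * c j)" for j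
  have d: "(\<Sum>j\<in>insert x S. d j * v j i) = (\<Sum>j\<in>S. c j * (v x k * v j i - v j k * v x i))" for i
  proof -
    have "(\<Sum>j\<in>insert x S. d j * v j i) =
        - (\<Sum>j\<in>S. c j * v j k) * v x i + (\<Sum>j\<in>S. v x k * c j * v j i)"
      using assms(2,3) by (auto simp: d_def intro!: sum.cong)
    then show ?thesis
      by (simp add: right_diff_distrib sum_subtractf sum_distrib_left mult_ac)
  qed
  have "int p dvd (\<Sum>j\<in>insert x S. d j * v j i)" if "i < Suc r" for i
  proof (cases i k rule: linorder_cases)
    case less
    then show ?thesis
      using c[rule_format, of i] k that unfolding d skip_def by simp
  next
    \<comment> \<open>Every projected vector vanishes in coordinate \<open>k\<close>, so the
      coordinate left out imposes no further condition on \<open>c\<close>.\<close>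
    case equal
    then show ?thesis
      unfolding d by (simp add: mult.commute)
  next
    case greater
    then obtain i' where "i = Suc i'" "k \<le> i'"
      by (cases i) auto
    then show ?thesis
      using c[rule_format, of i'] that unfolding d skip_def by simp
  qed
  then have "int p dvd d j"
    using assms(4) j unfolding indep_mod_def by blast
  moreover have "d j = v x k * c j"
    using j assms(3) by (auto simp: d_def)
  ultimately show "int p dvd c j"
    using k(2) assms(1) by (simp add: prime_dvd_mult_iff)
qed

section \<open>Skeleta of simplices\<close>

text \<open>In coding terms, the vectors are the columns of a parity check matrix with
  \<open>r\<close> rows of a code of length \<open>m + 1\<close> over the field of \<open>p\<close>
  elements, all of whose nonzero words have weight at least \<open>k + 2\<close>.\<close>

definition generic_mod :: "nat \<Rightarrow> nat \<Rightarrow> nat \<Rightarrow> nat \<Rightarrow> bool" where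
  "generic_mod p k m r \<longleftrightarrow>
     (\<exists>v. \<forall>\<sigma>. \<sigma> \<subseteq> {1..m + 1} \<and> card \<sigma> \<le> k + 1 \<longrightarrow> indep_mod p r v \<sigma>)"

lemma skeleton_std_simplex_iff:
  "\<sigma> \<in> skeleton k (std_simplex m) \<longleftrightarrow> \<sigma> \<subseteq> {1..m + 1} \<and> card \<sigma> \<le> k + 1"
  by (simp add: skeleton_def std_simplex_def)

lemma vertices_skeleton_std_simplex: "vertices (skeleton k (std_simplex m)) = {1..m + 1}"
proof -
  have "{x} \<in> skeleton k (std_simplex m)" if "x \<in> {1..m + 1}" for x
    using that by (simp add: skeleton_std_simplex_iff)
  then show ?thesis
    unfolding vertices_def by (fastforce simp: skeleton_std_simplex_iff)
qed

lemma buchstaber_skeleton_std_simplex: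
  assumes "prime p"
  shows "buchstaber p (skeleton k (std_simplex m)) = int (m + 1) - int (LEAST r. generic_mod p k m r)"
  unfolding buchstaber_def generic_mod_def vertices_skeleton_std_simplex
    nondegenerate_map_iff_indep_mod[OF assms simplicial_complex_skeleton_std_simplex]
    Ball_def skeleton_std_simplex_iff
  by simp

text \<open>This guarantees that the least dimension is attained. Vertices are numbered from 1 and
  coordinates from 0, so vertex \<open>Suc i\<close> takes axis \<open>i\<close>.\<close>

lemma generic_mod_coordinate_axes: "generic_mod p k m (m + 1)"
proof -
  have "indep_mod p (m + 1) (\<lambda>j i. of_bool (j = Suc i)) \<sigma>" if "\<sigma> \<subseteq> {1..m + 1}" for \<sigma>
    unfolding indep_mod_def
  proof (intro allI impI ballI)
    fix c :: "nat \<Rightarrow> int" and j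
    assume c: "\<forall>i<m + 1. int p dvd (\<Sum>j\<in>\<sigma>. c j * of_bool (j = Suc i))" and j: "j \<in> \<sigma>"
    have "j \<in> {1..m + 1}"
      using that j by blast
    then obtain i where i: "j = Suc i" "i < m + 1"
      by (cases j) auto
    have "finite \<sigma>"
      using that finite_subset by blast
    then show "int p dvd c j"
      using c[rule_format, OF i(2)] i(1) j
      by (simp add: of_bool_def if_distrib[of "\<lambda>x. _ * x"] cong: if_cong)
  qed
  then show ?thesis
    unfolding generic_mod_def by blast
qed

lemma generic_mod_restrict:
  "generic_mod p k (m + 1) r \<Longrightarrow> generic_mod p k m r"
  unfolding generic_mod_def
proof (elim exE, intro exI allI impI)
  fix v :: "nat \<Rightarrow> nat \<Rightarrow> int" and \<sigma>
  assume "\<forall>\<sigma>. \<sigma> \<subseteq> {1..m + 1 + 1} \<and> card \<sigma> \<le> k + 1 \<longrightarrow> indep_mod p r v \<sigma>"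
    and "\<sigma> \<subseteq> {1..m + 1} \<and> card \<sigma> \<le> k + 1"
  moreover have "{1..m + 1} \<subseteq> {1..m + 1 + 1}"
    by simp
  ultimately show "indep_mod p r v \<sigma>"
    by blast
qed

lemma generic_mod_add_vertex:
  assumes "generic_mod p k m r"
  shows "generic_mod p k (m + 1) (Suc r)"
proof -
  obtain v where v: "\<And>\<sigma>. \<sigma> \<subseteq> {1..m + 1} \<Longrightarrow> card \<sigma> \<le> k + 1 \<Longrightarrow> indep_mod p r v \<sigma>"
    using assms unfolding generic_mod_def by blast
  let ?w = "\<lambda>j i. if j = m + 2 then of_bool (i = r) else of_bool (i < r) * v j i"
  have "indep_mod p (Suc r) ?w \<sigma>" if "\<sigma> \<subseteq> {1..m + 1 + 1}" "card \<sigma> \<le> k + 1" for \<sigma>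
  proof (rule indep_mod_add_coordinate)
    show fin: "finite \<sigma>"
      using that finite_subset by blast
    have "\<sigma> - {m + 2} \<subseteq> {1..m + 1}"
      using that(1) by force
    moreover have "card (\<sigma> - {m + 2}) \<le> k + 1"
      using that(2) card_Diff1_le[of \<sigma> "m + 2"] by linarith
    ultimately show "indep_mod p r v (\<sigma> - {m + 2})"
      by (rule v)
  qed
  then show ?thesis
    unfolding generic_mod_def by blast
qed

text \<open>At most \<open>k + 1\<close> of the first \<open>m + 1\<close> vertices form, with the
  last one, a set of at most \<open>k + 2\<close> vertices, whose vectors are independent by
  assumption. Projecting along the last vector keeps the others independent in one dimension
  less.\<close>

lemma generic_mod_project_vertex:
  assumes "prime p" "generic_mod p (k + 1) (m + 1) r"
  obtains r' where "r = Suc r'" "generic_mod p k m r'"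
proof -
  let ?x = "m + 2"
  obtain v where
    "\<forall>\<sigma>. \<sigma> \<subseteq> {1..m + 1 + 1} \<and> card \<sigma> \<le> k + 1 + 1 \<longrightarrow> indep_mod p r v \<sigma>"
    using assms(2) unfolding generic_mod_def by blast
  then have v: "indep_mod p r v \<sigma>" if "\<sigma> \<subseteq> {1..m + 2}" "card \<sigma> \<le> k + 2" for \<sigma>
    using that by simp
  \<comment> \<open>The last vertex alone is a simplex, so its vector is nonzero modulo
    \<open>p\<close>. This provides the coordinate to project away and shows that \<open>r\<close>
    is positive.\<close>
  obtain i where i: "i < r" "\<not> int p dvd v ?x i"
    using indep_mod_singletonD[OF assms(1) v[of "{?x}"]] by auto
  then obtain r' where r': "r = Suc r'"
    by (cases r) auto
  define skip where "skip j = (if j < i then j else Suc j)" for j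
  have "indep_mod p r' (\<lambda>j l. v ?x i * v j (skip l) - v j i * v ?x (skip l)) \<sigma>"
    if "\<sigma> \<subseteq> {1..m + 1}" "card \<sigma> \<le> k + 1" for \<sigma>
    unfolding skip_def
  proof (rule indep_mod_project[OF assms(1)])
    show fin: "finite \<sigma>"
      using that finite_subset by blast
    show "?x \<notin> \<sigma>"
      using that by auto
    then have "card (insert ?x \<sigma>) \<le> k + 2"
      using that fin by simp
    moreover have "insert ?x \<sigma> \<subseteq> {1..m + 2}"
      using that(1) by force
    ultimately show "indep_mod p (Suc r') v (insert ?x \<sigma>)"
      using v r' by blast
  qed (use i r' in auto)
  then have "generic_mod p k m r'"
    unfolding generic_mod_def by blast
  with r' show thesis
    by (rule that)
qed

theorem proposition5p19:
  fixes p k m :: nat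
  assumes "prime p" and "k \<le> m"
  shows "buchstaber p (skeleton (k + 1) (std_simplex (m + 1)))
           \<le> buchstaber p (skeleton k (std_simplex m)) \<and>
         buchstaber p (skeleton k (std_simplex m))
           \<le> buchstaber p (skeleton k (std_simplex (m + 1))) \<and>
         buchstaber p (skeleton k (std_simplex (m + 1)))
           \<le> buchstaber p (skeleton k (std_simplex m)) + 1"
proof -
  define R where "R k m = (LEAST r. generic_mod p k m r)" for k m
  have R: "generic_mod p k m (R k m)" for k m
    unfolding R_def using generic_mod_coordinate_axes by (rule LeastI)
  have R_le: "R k m \<le> r" if "generic_mod p k m r" for k m r
    unfolding R_def using that by (rule Least_le)
  have "R k m + 1 \<le> R (k + 1) (m + 1)"
    using generic_mod_project_vertex[OF assms(1) R] R_le
    by (metis Suc_eq_plus1 Suc_le_mono)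
  moreover have "R k m \<le> R k (m + 1)"
    by (rule R_le[OF generic_mod_restrict[OF R]])
  moreover have "R k (m + 1) \<le> R k m + 1"
    using R_le[OF generic_mod_add_vertex[OF R]] by simp
  \<comment> \<open>The invariant is \<open>m + 1\<close> minus \<open>R k m\<close>, so signs
    reverse: the three bounds on \<open>R\<close> yield the first, third and second inequality, in
    this order, once the extra vertex of the larger simplex is counted.\<close>
  ultimately show ?thesis
    unfolding buchstaber_skeleton_std_simplex[OF assms(1)] R_def[symmetric] by linarith
qed

end
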